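(* Let $q\ge 1$ be an integer and let $A\in \mathrm{SL}_{q+1}(\mathbb{Z})$ be such that there is a direct sum decomposition $\mathbb{R}^{q+1}=E^s\oplus E^u$ into linear subspaces, each invariant by $A$, with $\dim(E^u)=1$. If there exist a positive definite symmetric bilinear form $b$ on $E^s$ and a real number $\lambda>1$ such that $\lambda A|_{E^s}$ is orthogonal with respect to $b$ (that is, $b(\lambda Ax,\lambda Ay)=b(x,y)$ for all $x,y\in E^s$), then $q\in\{1,2\}$.
   Context: $\mathrm{SL}_{q+1}(\mathbb{Z})$ denotes the group of $(q+1)\times(q+1)$ integer matrices of determinant $1$, acting linearly on $\mathbb{R}^{q+1}$. *)

theory Defs
  imports "HOL-Analysis.Analysis"
begin

definition SL_int :: "(int ^ 'n ^ 'n) set" where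
  "SL_int = {A. det A = 1}"

abbreviation real_mat :: "int ^ 'n ^ 'm \<Rightarrow> real ^ 'n ^ 'm" where
  "real_mat A \<equiv> map_matrix real_of_int A"

definition direct_sum_decomp :: "'a::real_vector set \<Rightarrow> 'a set \<Rightarrow> bool" where
  "direct_sum_decomp S T \<longleftrightarrow>
     subspace S \<and> subspace T \<and> S \<inter> T = {0} \<and> {x + y |x y. x \<in> S \<and> y \<in> T} = UNIV"

definition invariant_under :: "real ^ 'n ^ 'n \<Rightarrow> (real ^ 'n) set \<Rightarrow> bool" where
  "invariant_under M S \<longleftrightarrow> (\<forall>x\<in>S. M *v x \<in> S)"

(* The library's bilinear concerns forms on a whole type. Here the form lives on a subspace S:
   only the values b x y with x and y in S matter, and linearity in the second argument
   follows from symmetry. *)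
definition pos_def_symmetric_form_on ::
  "'a::real_vector set \<Rightarrow> ('a \<Rightarrow> 'a \<Rightarrow> real) \<Rightarrow> bool" where
  "pos_def_symmetric_form_on S b \<longleftrightarrow>
     (\<forall>x\<in>S. \<forall>y\<in>S. \<forall>z\<in>S. b (x + y) z = b x z + b y z) \<and>
     (\<forall>c. \<forall>x\<in>S. \<forall>y\<in>S. b (c *\<^sub>R x) y = c * b x y) \<and>
     (\<forall>x\<in>S. \<forall>y\<in>S. b x y = b y x) \<and>
     (\<forall>x\<in>S. x \<noteq> 0 \<longrightarrow> b x x > 0)"

definition orthogonal_on ::
  "(real ^ 'n) set \<Rightarrow> (real ^ 'n \<Rightarrow> real ^ 'n \<Rightarrow> real) \<Rightarrow> real ^ 'n ^ 'n \<Rightarrow> bool" where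
  "orthogonal_on S b M \<longleftrightarrow> (\<forall>x\<in>S. \<forall>y\<in>S. b (M *v x) (M *v y) = b x y)"

end

theory Submission
  imports Defs
begin

text \<open>
  Write \<open>\<mu>\<close> for the eigenvalue of \<open>A\<close> on the line \<open>E\<^sup>u\<close> and \<open>r = 1/\<lambda> < 1\<close> for the ratio by which \<open>A\<close>
  contracts \<open>E\<^sup>s\<close>. Since \<open>A\<close> has determinant 1, \<open>\<bar>\<mu>\<bar> = 1 / r ^ q\<close>, so \<open>\<mu>\<close> is an algebraic unit all of whose
  conjugates other than \<open>\<mu>\<close> itself have the same modulus \<open>r\<close>. The classical argument moves one of these
  conjugates to \<open>\<mu>\<close> by a Galois automorphism, applied to the relation that all the products
  \<open>\<alpha> * cnj \<alpha>\<close> are equal. The proof below replaces the Galois group by traces.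

  The map that is \<open>\<lambda>A\<close> on \<open>E\<^sup>s\<close> and the identity on \<open>E\<^sup>u\<close> preserves a positive definite form, so its
  inverse has the same trace. With the integers \<open>t = tr A\<close> and \<open>s = tr A\<^sup>-\<^sup>1\<close> this reads
  \<open>t - \<mu> = r\<^sup>2 (s - 1/\<mu>)\<close> (\<open>conformal_trace_inverse\<close>). Raising it to the power \<open>q\<close> removes \<open>r\<close>, because
  \<open>\<mu>\<^sup>2 r ^ (2 * q) = 1\<close> (\<open>conformal_det\<close>), and leaves a polynomial relation with integer coefficients,
  \<open>(s \<mu> - 1) ^ q = \<mu> ^ (q + 2) * (t - \<mu>) ^ q\<close>. Hence the integer matrix
  \<open>F = (s A - 1) ^ q - A ^ (q + 2) * (t - A) ^ q\<close> kills \<open>E\<^sup>u\<close>.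

  An integer matrix that kills \<open>E\<^sup>u\<close> also kills a nonzero vector of \<open>E\<^sup>s\<close>
  (\<open>annihilated_stable_vector\<close>); this plays the role of the irreducibility of the characteristic
  polynomial. Indeed \<open>F\<close> has a nonzero integer vector in its kernel, and \<open>E\<^sup>u\<close> contains no such vector,
  since the powers of \<open>A\<^sup>-\<^sup>1\<close> would shrink it to 0 within the integer lattice. On \<open>E\<^sup>s\<close> the sizes of
  the two terms of \<open>F\<close> are known. As both must agree on the killed vector,
  \<open>r ^ (q + 2) * \<bar>t\<bar> ^ q\<close> is bounded by \<open>(\<bar>s\<bar> r + 1) ^ q\<close> up to a factor (\<open>conformal_integral_bound\<close>).

  Apply this to the powers \<open>A\<^sup>k\<close>, which satisfy the same hypotheses with \<open>r\<^sup>k\<close> for \<open>r\<close>. The trace of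
  an isometry is bounded independently of \<open>k\<close> (\<open>form_trace_bound\<close>), so in terms of the new ratio \<open>r\<close> the
  number \<open>\<bar>s\<bar> r\<close> stays bounded and \<open>\<bar>t\<bar>\<close> has the order of \<open>1 / r ^ q\<close>. As \<open>r\<close> tends to 0, boundedness of
  \<open>r powr (q + 2 - q * q)\<close> forces \<open>q * q \<le> q + 2\<close>, that is \<open>q \<le> 2\<close> (\<open>contraction_ratio_not_small\<close>).
\<close>

section \<open>Determinant of a rank-one perturbation\<close>

lemma det_mat_1_replace_row:
  fixes w :: "'a::field ^ 'n"
  shows "det (\<chi> i. if i = k then w else axis i 1) = w $ k"
proof -
  have r: "row i (mat 1 :: 'a^'n^'n) = axis i 1" for i
    by (simp add: row_def mat_def axis_def vec_eq_iff eq_commute)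
  show ?thesis
    using cramer_lemma_transpose[where A="mat 1 :: 'a^'n^'n" and x=w and k=k]
    unfolding r basis_expansion by simp
qed

text \<open>
  Each row \<open>e\<^sub>i + a\<^sub>i w\<close> may be reduced to \<open>e\<^sub>i\<close> by subtracting a multiple of row \<open>k\<close>, which is \<open>w\<close>.
\<close>

lemma det_unit_rows_plus_multiples:
  fixes w :: "'a::field ^ 'n"
  assumes "finite S" "k \<notin> S"
  shows "det (\<chi> i. if i = k then w else if i \<in> S then axis i 1 + a i *s w else axis i 1) = w $ k"
  using assms
proof (induction S)
  case empty
  then show ?case using det_mat_1_replace_row[of k w] by (simp cong: if_cong)
next
  case (insert j S)
  define c where "c = (\<lambda>i. if i = k then w else if i \<in> S then axis i 1 + a i *s w else axis i 1)"
  from insert.prems have jk: "j \<noteq> k" by auto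
  have "det (\<chi> i. if i = k then w else if i \<in> insert j S then axis i 1 + a i *s w else axis i 1)
      = det (\<chi> i. if i = j then axis i 1 + a i *s w else c i)"
    using jk by (intro arg_cong[where f=det]) (auto simp: c_def vec_eq_iff)
  also have "\<dots> = det (\<chi> i. if i = j then axis i 1 else c i) + det (\<chi> i. if i = j then a i *s w else c i)"
    by (rule det_row_add)
  also have "det (\<chi> i. if i = j then a i *s w else c i) = a j * det (\<chi> i. if i = j then w else c i)"
    using det_row_mul[of j "a j" "\<lambda>_. w" c] by (simp cong: if_cong)
  also have "det (\<chi> i. if i = j then w else c i) = 0"
    by (rule det_identical_rows[OF jk]) (use jk in \<open>auto simp: row_def vec_eq_iff c_def\<close>)
  also have "(\<chi> i. if i = j then axis i 1 else c i) = (\<chi> i. c i)"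
    using insert.hyps jk by (auto simp: c_def vec_eq_iff)
  also have "det (\<chi> i. c i) = w $ k"
    using insert unfolding c_def by simp
  finally show ?case by simp
qed

text \<open>
  The matrix determinant lemma. The rank-one term is switched on row by row: since the determinant is
  additive in row \<open>k\<close>, doing so adds \<open>u\<^sub>k\<close> times a determinant in which row \<open>k\<close> is \<open>w\<close>.
\<close>

lemma det_mat_1_plus_rank_one:
  fixes u w :: "'a::field ^ 'n"
  shows "det (mat 1 + (\<chi> i j. u $ i * w $ j)) = 1 + (\<Sum>i\<in>UNIV. u $ i * w $ i)"
proof -
  have "det (\<chi> i. if i \<in> S then axis i 1 + u $ i *s w else axis i 1) = 1 + (\<Sum>i\<in>S. u $ i * w $ i)"
    if "finite S" for S
    using that
  proof (induction S)
    case empty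
    have "(\<chi> i. axis i 1) = (mat 1 :: 'a^'n^'n)"
      by (simp add: mat_def axis_def vec_eq_iff eq_commute)
    then show ?case by simp
  next
    case (insert k S)
    define c where "c = (\<lambda>i. if i \<in> S then axis i 1 + u $ i *s w else axis i 1)"
    have "det (\<chi> i. if i \<in> insert k S then axis i 1 + u $ i *s w else axis i 1)
      = det (\<chi> i. if i = k then axis i 1 + u $ i *s w else c i)"
      by (intro arg_cong[where f=det]) (auto simp: c_def vec_eq_iff)
    also have "\<dots> = det (\<chi> i. if i = k then axis i 1 else c i) + det (\<chi> i. if i = k then u $ i *s w else c i)"
      by (rule det_row_add)
    also have "det (\<chi> i. if i = k then u $ i *s w else c i) = u $ k * det (\<chi> i. if i = k then w else c i)"
      using det_row_mul[of k "u $ k" "\<lambda>_. w" c] by (simp cong: if_cong)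
    also have "det (\<chi> i. if i = k then w else c i) = w $ k"
      unfolding c_def by (rule det_unit_rows_plus_multiples) (use insert in auto)
    also have "(\<chi> i. if i = k then axis i 1 else c i) = (\<chi> i. c i)"
      using insert.hyps by (auto simp: c_def vec_eq_iff)
    also have "det (\<chi> i. c i) = 1 + (\<Sum>i\<in>S. u $ i * w $ i)"
      using insert unfolding c_def by simp
    finally show ?case using insert.hyps by (simp add: algebra_simps)
  qed
  from this[of UNIV] have "det (\<chi> i. axis i 1 + u $ i *s w) = 1 + (\<Sum>i\<in>UNIV. u $ i * w $ i)"
    by simp
  moreover have "(\<chi> i. axis i 1 + u $ i *s w) = mat 1 + (\<chi> i j. u $ i * w $ j)"
    by (simp add: mat_def axis_def vec_eq_iff eq_commute)
  ultimately show ?thesis by simp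
qed

section \<open>Integer matrices\<close>

lemma det_map_matrix_of_int:
  "det (map_matrix of_int M :: 'a::comm_ring_1 ^ 'n ^ 'n) = of_int (det M)"
  by (simp add: det_def)

lemma trace_map_matrix_of_int: "trace (map_matrix of_int M :: 'a::comm_ring_1 ^ 'n ^ 'n) = of_int (trace M)"
  by (simp add: trace_def)

lemma map_matrix_of_int_mult:
  "map_matrix of_int (A ** B) = (map_matrix of_int A ** map_matrix of_int B :: 'a::comm_ring_1 ^ 'n ^ 'm)"
  by (simp add: matrix_matrix_mult_def vec_eq_iff)

lemma map_matrix_of_int_mult_vec:
  "(map_matrix of_int A :: 'a::comm_ring_1 ^ 'n ^ 'm) *v (\<chi> i. of_int (x $ i)) = (\<chi> i. of_int ((A *v x) $ i))"
  by (simp add: matrix_vector_mult_def vec_eq_iff)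

lemma map_matrix_of_int_diff:
  "map_matrix of_int (A - B) = (map_matrix of_int A - map_matrix of_int B :: 'a::ring_1 ^ 'n ^ 'm)"
  by (simp add: vec_eq_iff)

lemma map_matrix_of_int_mat: "map_matrix of_int (mat c) = mat (of_int c :: 'a::ring_1)"
  by (simp add: vec_eq_iff mat_def)

lemma rational_vector_common_denominator:
  fixes x :: "rat ^ 'n"
  obtains d :: int and y :: "int ^ 'n" where "d \<noteq> 0" "\<And>i. of_int (y $ i) = of_int d * x $ i"
proof -
  define b where "b = (\<lambda>i. snd (quotient_of (x $ i)))"
  define a where "a = (\<lambda>i. fst (quotient_of (x $ i)))"
  have b: "b i \<noteq> 0" for i
    using quotient_of_denom_pos'[of "x $ i"] by (simp add: b_def)
  have x: "x $ i = of_int (a i) / of_int (b i)" for i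
    using quotient_of_div[of "x $ i"] by (simp add: a_def b_def)
  show thesis
  proof (rule that[of "\<Prod>i\<in>UNIV. b i" "\<chi> i. a i * (\<Prod>j\<in>UNIV - {i}. b j)"])
    show "(\<Prod>i\<in>UNIV. b i) \<noteq> 0" using b by simp
    show "of_int ((\<chi> i. a i * (\<Prod>j\<in>UNIV - {i}. b j)) $ i) = of_int (\<Prod>i\<in>UNIV. b i) * x $ i" for i
      using b by (simp add: x prod.remove[of UNIV i b])
  qed
qed

lemma singular_int_matrix_kernel:
  fixes M :: "int ^ 'n ^ 'n"
  assumes "det M = 0"
  obtains y where "y \<noteq> 0" "M *v y = 0"
proof -
  let ?R = "map_matrix of_int M :: rat ^ 'n ^ 'n"
  have "det ?R = 0" using assms by (simp add: det_map_matrix_of_int)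
  then have "\<not> invertible ?R" by (simp add: invertible_det_nz)
  then obtain x where x: "?R *v x = 0" "x \<noteq> 0"
    using matrix_left_invertible_ker[of ?R] by (auto simp: invertible_left_inverse)
  obtain d y where dy: "d \<noteq> 0" "\<And>i. of_int (y $ i) = of_int d * x $ i"
    using rational_vector_common_denominator[of x] by blast
  have *: "(\<chi> i. of_int (y $ i)) = of_int d *s x" by (simp add: vec_eq_iff dy)
  have "(\<chi> i. of_int ((M *v y) $ i)) = ?R *v (of_int d *s x)"
    unfolding *[symmetric] by (simp add: map_matrix_of_int_mult_vec)
  also have "\<dots> = 0" using x by (simp add: vec.scale)
  finally have "M *v y = 0" by (simp add: vec_eq_iff)
  moreover have "y \<noteq> 0"
  proof
    assume "y = 0"
    then have "x $ i = 0" for i using dy(2)[of i] dy(1) by simp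
    then show False using x by (simp add: vec_eq_iff)
  qed
  ultimately show thesis using that by blast
qed

text \<open>
  Cramer's rule, applied over the reals, gives the entries of the inverse as determinants of integer
  matrices.
\<close>

lemma unimodular_int_matrix_inverse:
  fixes A :: "int ^ 'n ^ 'n"
  assumes "det A = 1"
  obtains A' where "A ** A' = mat 1"
proof -
  define A' where "A' = (\<chi> k l. det (\<chi> i j. if j = k then axis l 1 $ i else A $ i $ j))"
  let ?R = "real_mat A"
  have d: "det ?R = 1" using assms det_map_matrix_of_int[of A, where 'a=real] by simp
  have "?R *v column l (real_mat A') = axis l 1" for l
  proof -
    have "column l (real_mat A') = (\<chi> k. det (\<chi> i j. if j = k then axis l 1 $ i else ?R $ i $ j) / det ?R)"
    proof -
      have "real_of_int (det (\<chi> i j. if j = k then axis l 1 $ i else A $ i $ j))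
        = det (\<chi> i j. if j = k then axis l 1 $ i else ?R $ i $ j)" for k
        unfolding det_map_matrix_of_int[symmetric]
        by (intro arg_cong[where f=det]) (simp add: vec_eq_iff axis_def)
      then show ?thesis by (simp add: d A'_def column_def)
    qed
    then show ?thesis using cramer[of ?R "column l (real_mat A')" "axis l 1"] d by simp
  qed
  then have "(?R ** real_mat A') $ i $ l = mat 1 $ i $ l" for i l
    by (auto simp: matrix_matrix_mult_def matrix_vector_mult_def column_def vec_eq_iff mat_def axis_def)
  then have "real_mat (A ** A') = real_mat (mat 1)"
    by (simp add: map_matrix_of_int_mult map_matrix_of_int_mat vec_eq_iff)
  then have "A ** A' = mat 1" by (simp add: vec_eq_iff)
  then show thesis by (rule that)
qed

section \<open>Powers of matrices\<close>

text \<open>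
  The type class power on vectors acts on each component, so the power with respect to the matrix product
  needs a function of its own.
\<close>

primrec matrix_power :: "'a::semiring_1 ^ 'n ^ 'n \<Rightarrow> nat \<Rightarrow> 'a ^ 'n ^ 'n" where
  "matrix_power M 0 = mat 1"
| "matrix_power M (Suc k) = M ** matrix_power M k"

lemma map_matrix_of_int_power:
  "map_matrix of_int (matrix_power M k) = (matrix_power (map_matrix of_int M) k :: 'a::comm_ring_1 ^ 'n ^ 'n)"
  by (induction k) (simp_all add: map_matrix_of_int_mult map_matrix_of_int_mat)

lemma matrix_power_commute: "matrix_power M k ** M = M ** matrix_power M k"
  by (induction k) (simp_all add: matrix_mul_assoc[symmetric])

lemma matrix_power_inverse:
  assumes "A ** A' = mat 1"
  shows "matrix_power A k ** matrix_power A' k = mat 1"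
proof (induction k)
  case (Suc k)
  have "matrix_power A (Suc k) = matrix_power A k ** A"
    by (simp add: matrix_power_commute)
  then have "matrix_power A (Suc k) ** matrix_power A' (Suc k)
      = matrix_power A k ** (A ** A') ** matrix_power A' k"
    by (simp only: matrix_power.simps matrix_mul_assoc)
  then show ?case using Suc assms by simp
qed simp

lemma matrix_power_eigenvector:
  fixes M :: "real ^ 'n ^ 'n"
  assumes "M *v u = c *\<^sub>R u"
  shows "matrix_power M k *v u = c ^ k *\<^sub>R u"
  by (induction k)
    (simp_all add: matrix_vector_mul_assoc[symmetric] matrix_vector_mult_scaleR assms)

lemma mat_mult_vec: "mat c *v x = c *\<^sub>R (x :: real ^ 'n)"
proof -
  have "mat c = c *\<^sub>R (mat 1 :: real ^ 'n ^ 'n)"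
    by (simp add: vec_eq_iff mat_def)
  then show ?thesis
    by (simp flip: scaleR_matrix_vector_assoc)
qed

lemma trace_scaleR: "trace (c *\<^sub>R A) = c * trace (A :: real ^ 'n ^ 'n)"
  by (simp add: trace_def sum_distrib_left)

text \<open>
  The vectors \<open>A\<^sup>k y = c\<^sup>k y\<close> are integral and tend to 0, so one of them is 0, although neither \<open>c\<close> nor \<open>y\<close> is.
\<close>

lemma contracted_eigenvector_not_integral:
  fixes A :: "int ^ 'n ^ 'n" and y :: "int ^ 'n"
  assumes "real_mat A *v (\<chi> i. real_of_int (y $ i)) = c *\<^sub>R (\<chi> i. real_of_int (y $ i))"
    and "c \<noteq> 0" "\<bar>c\<bar> < 1"
  shows "y = 0"
proof (rule ccontr)
  assume "y \<noteq> 0"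
  then obtain i where i: "y $ i \<noteq> 0" by (auto simp: vec_eq_iff)
  obtain k where k: "\<bar>c\<bar> ^ k < 1 / \<bar>real_of_int (y $ i)\<bar>"
    using real_arch_pow_inv[of "1 / \<bar>real_of_int (y $ i)\<bar>" "\<bar>c\<bar>"] i assms(3) by auto
  have "(\<chi> i. real_of_int ((matrix_power A k *v y) $ i))
      = real_mat (matrix_power A k) *v (\<chi> i. real_of_int (y $ i))"
    by (simp add: map_matrix_of_int_mult_vec)
  also have "\<dots> = c ^ k *\<^sub>R (\<chi> i. real_of_int (y $ i))"
    unfolding map_matrix_of_int_power by (rule matrix_power_eigenvector) (rule assms)
  finally have *: "real_of_int ((matrix_power A k *v y) $ i) = c ^ k * real_of_int (y $ i)"
    by (simp add: vec_eq_iff)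
  then have "\<bar>real_of_int ((matrix_power A k *v y) $ i)\<bar> < 1"
    using k i by (simp add: abs_mult power_abs field_simps)
  then have "(matrix_power A k *v y) $ i = 0" by linarith
  then show False using * i assms by simp
qed

section \<open>Isometries of a form adapted to a hyperplane and a line\<close>

text \<open>
  The hyperplane \<open>{x. w \<bullet> x = 0}\<close> is the stable space and the line through \<open>u\<close> the unstable one. The form
  on the stable space is extended to the whole space, with the two summands orthogonal, so that
  isometries can be treated by matrices.
\<close>

locale adapted_form =
  fixes form :: "real ^ 'n \<Rightarrow> real ^ 'n \<Rightarrow> real" and u w :: "real ^ 'n"
  assumes bilinear: "bilinear form"
    and symmetric: "form x y = form y x"
    and positive: "x \<noteq> 0 \<Longrightarrow> form x x > 0"
    and pairing: "w \<bullet> u = 1"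
    and orthogonal: "w \<bullet> x = 0 \<Longrightarrow> form u x = 0"
begin

text \<open>
  The second condition says that \<open>w\<close> is an eigenvector of the transpose; given the first one, this means
  that the hyperplane is invariant.
\<close>

definition conformal :: "real \<Rightarrow> real \<Rightarrow> real ^ 'n ^ 'n \<Rightarrow> bool" where
  "conformal \<mu> r M \<longleftrightarrow> M *v u = \<mu> *\<^sub>R u \<and> (\<forall>x. w \<bullet> (M *v x) = \<mu> * (w \<bullet> x)) \<and>
     (\<forall>x y. w \<bullet> x = 0 \<longrightarrow> w \<bullet> y = 0 \<longrightarrow> form (M *v x) (M *v y) = r\<^sup>2 * form x y)"

definition gram :: "real ^ 'n ^ 'n" where
  "gram = (\<chi> i j. form (axis i 1) (axis j 1))"

text \<open>
  The projection onto the line through \<open>u\<close> along the hyperplane.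
\<close>

definition proj :: "real ^ 'n ^ 'n" where
  "proj = (\<chi> i j. u $ i * w $ j)"

lemmas form_simps = bilinear_ladd[OF bilinear] bilinear_radd[OF bilinear]
  bilinear_lsub[OF bilinear] bilinear_rsub[OF bilinear]
  bilinear_lmul[OF bilinear] bilinear_rmul[OF bilinear]

lemma form_gram: "form x y = x \<bullet> (gram *v y)"
proof -
  have e: "(\<Sum>i\<in>UNIV. z $ i *\<^sub>R axis i 1) = z" for z :: "real ^ 'n"
    using basis_expansion[of z] by (simp add: scalar_mult_eq_scaleR)
  have "form x y = form (\<Sum>i\<in>UNIV. x $ i *\<^sub>R axis i 1) (\<Sum>j\<in>UNIV. y $ j *\<^sub>R axis j 1)"
    by (simp only: e)
  also have "\<dots> = (\<Sum>i\<in>UNIV. \<Sum>j\<in>UNIV. form (x $ i *\<^sub>R axis i 1) (y $ j *\<^sub>R axis j 1))"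
    by (simp only: bilinear_sum[OF bilinear] sum.cartesian_product)
  also have "\<dots> = x \<bullet> (gram *v y)"
    by (simp add: form_simps gram_def inner_vec_def matrix_vector_mult_def sum_distrib_left
        mult_ac)
  finally show ?thesis .
qed

lemma gram_invertible: obtains G where "gram ** G = mat 1" "G ** gram = mat 1"
proof -
  have "x = 0" if "gram *v x = 0" for x
    using positive[of x] form_gram[of x x] that by fastforce
  then obtain G where "G ** gram = mat 1"
    using matrix_left_invertible_ker[of gram] by blast
  then show thesis using that matrix_left_right_inverse by blast
qed

lemma proj_mult: "proj *v x = (w \<bullet> x) *\<^sub>R u"
  by (simp add: proj_def vec_eq_iff matrix_vector_mult_def inner_vec_def sum_distrib_left mult_ac)

lemma trace_proj: "trace proj = 1"
  using pairing by (simp add: trace_def proj_def inner_vec_def mult.commute)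

text \<open>
  If \<open>f\<^sub>i\<close> is dual to the standard basis with respect to the form, then the trace of \<open>N\<close> is the sum of the
  numbers \<open>form (N e\<^sub>i) f\<^sub>i\<close>, and each of them is at most half of \<open>form e\<^sub>i e\<^sub>i + form f\<^sub>i f\<^sub>i\<close> when \<open>N\<close> is an
  isometry. What matters is that the bound depends on the form only: it is applied to all the powers of
  one matrix.
\<close>

lemma form_trace_bound:
  obtains C where "\<And>N. (\<And>x y. form (N *v x) (N *v y) = form x y) \<Longrightarrow> \<bar>trace N\<bar> \<le> C"
proof -
  obtain G where G: "gram ** G = mat 1" using gram_invertible by blast
  define f where "f = (\<lambda>i. G *v axis i 1)"
  have am: "\<bar>2 * form x y\<bar> \<le> form x x + form y y" for x y
  proof -
    have nn: "form z z \<ge> 0" for z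
      using positive[of z] bilinear_lzero[OF bilinear, of z] by (cases "z = 0") (auto intro: less_imp_le)
    show ?thesis
      using nn[of "x + y"] nn[of "x - y"] symmetric[of x y] by (simp add: form_simps abs_le_iff)
  qed
  show thesis
  proof (rule that[of "\<Sum>i\<in>UNIV. (form (axis i 1) (axis i 1) + form (f i) (f i)) / 2"])
    fix N :: "real ^ 'n ^ 'n" assume N: "\<And>x y. form (N *v x) (N *v y) = form x y"
    have "N $ i $ i = form (N *v axis i 1) (f i)" for i
    proof -
      have "form (N *v axis i 1) (f i) = (N *v axis i 1) \<bullet> ((gram ** G) *v axis i 1)"
        by (simp add: form_gram f_def matrix_vector_mul_assoc)
      then show ?thesis
        by (simp only: G matrix_vector_mul_lid) (simp add: inner_axis matrix_vector_mult_basis column_def)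
    qed
    then have "trace N = (\<Sum>i\<in>UNIV. form (N *v axis i 1) (f i))" by (simp add: trace_def)
    also have "\<bar>\<dots>\<bar> \<le> (\<Sum>i\<in>UNIV. \<bar>form (N *v axis i 1) (f i)\<bar>)" by (rule sum_abs)
    also have "\<dots> \<le> (\<Sum>i\<in>UNIV. (form (axis i 1) (axis i 1) + form (f i) (f i)) / 2)"
    proof (rule sum_mono)
      show "\<bar>form (N *v axis i 1) (f i)\<bar> \<le> (form (axis i 1) (axis i 1) + form (f i) (f i)) / 2" for i
        using am[of "N *v axis i 1" "f i"] N by simp
    qed
    finally show "\<bar>trace N\<bar> \<le> (\<Sum>i\<in>UNIV. (form (axis i 1) (axis i 1) + form (f i) (f i)) / 2)" .
  qed
qed

lemma isometry_gram:
  assumes "\<And>x y. form (N *v x) (N *v y) = form x y"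
  shows "transpose N ** gram ** N = gram"
proof -
  have "(transpose N ** gram ** N) *v y = gram *v y" for y
  proof (rule vector_eq_ldot[THEN iffD1], intro allI)
    fix x
    have "x \<bullet> ((transpose N ** gram ** N) *v y) = (N *v x) \<bullet> (gram *v (N *v y))"
      unfolding matrix_vector_mul_assoc[symmetric] dot_lmul_matrix[symmetric] by simp
    then show "x \<bullet> ((transpose N ** gram ** N) *v y) = x \<bullet> (gram *v y)"
      using assms[of x y] by (simp add: form_gram)
  qed
  then show ?thesis by (simp add: matrix_eq)
qed

lemma isometry_det:
  assumes "\<And>x y. form (N *v x) (N *v y) = form x y"
  shows "\<bar>det N\<bar> = 1"
proof -
  obtain G where "gram ** G = mat 1" using gram_invertible by blast
  then have "det gram * det G = 1" by (metis det_I det_mul)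
  then have "det gram \<noteq> 0" by auto
  moreover have "det N * det gram * det N = det gram"
    using arg_cong[OF isometry_gram[OF assms], of det] by (simp add: det_mul)
  ultimately have "(det N)\<^sup>2 = 1" by (simp add: power2_eq_square)
  then show ?thesis by (auto simp: power2_eq_1_iff)
qed

text \<open>
  By \<open>isometry_gram\<close> the Gram matrix conjugates the inverse of an isometry into its transpose.
\<close>

lemma isometry_trace_inverse:
  assumes N: "\<And>x y. form (N *v x) (N *v y) = form x y" and inv: "N ** N' = mat 1"
  shows "trace N' = trace N"
proof -
  obtain G where G: "gram ** G = mat 1" "G ** gram = mat 1" using gram_invertible by blast
  have "gram ** N' = (transpose N ** gram ** N) ** N'" using isometry_gram[OF N] by simp
  also have "\<dots> = transpose N ** gram" using inv by (simp add: matrix_mul_assoc[symmetric])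
  finally have gN': "gram ** N' = transpose N ** gram" .
  have "N' = (G ** gram) ** N'" by (simp only: G matrix_mul_lid)
  also have "\<dots> = G ** (transpose N ** gram)" by (simp only: gN' flip: matrix_mul_assoc)
  finally have "N' = G ** (transpose N ** gram)" .
  then have "trace N' = trace ((transpose N ** gram) ** G)"
    by (simp only: trace_mul_sym[of G])
  also have "\<dots> = trace (transpose N)" using G by (simp add: matrix_mul_assoc[symmetric])
  finally show ?thesis by (simp add: trace_def transpose_def)
qed

section \<open>Conformal matrices\<close>

text \<open>
  The matrix that acts as \<open>M / r\<close> on the hyperplane and as the identity on the line, see
  \<open>normalized_mult\<close>. It is an isometry when \<open>M\<close> is conformal with eigenvalue \<open>\<mu>\<close> and ratio \<open>r\<close>, and its
  determinant and trace determine how \<open>\<mu>\<close>, \<open>r\<close> and the trace of \<open>M\<close> are related.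
\<close>

definition normalized :: "real \<Rightarrow> real \<Rightarrow> real ^ 'n ^ 'n \<Rightarrow> real ^ 'n ^ 'n" where
  "normalized \<mu> r M = (1 / r) *\<^sub>R M + (1 - \<mu> / r) *\<^sub>R proj"

lemma trace_normalized: "trace (normalized \<mu> r M) = 1 + (trace M - \<mu>) / r"
  by (simp add: normalized_def trace_add trace_scaleR trace_proj diff_divide_distrib)

lemma normalized_mult:
  assumes "conformal \<mu> r M"
  shows "normalized \<mu> r M *v x = (1 / r) *\<^sub>R (M *v (x - (w \<bullet> x) *\<^sub>R u)) + (w \<bullet> x) *\<^sub>R u"
  using assms
  by (simp add: normalized_def conformal_def matrix_vector_mult_add_rdistrib proj_mult
      scaleR_matrix_vector_assoc[symmetric] matrix_vector_mult_diff_distrib matrix_vector_mult_scaleR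
      algebra_simps)

lemma normalized_isometry:
  assumes M: "conformal \<mu> r M" and r: "r \<noteq> 0"
  shows "form (normalized \<mu> r M *v x) (normalized \<mu> r M *v y) = form x y"
proof -
  define p where "p x = x - (w \<bullet> x) *\<^sub>R u" for x
  have p: "w \<bullet> p x = 0" for x using pairing by (simp add: p_def inner_diff_right)
  have split: "x = p x + (w \<bullet> x) *\<^sub>R u" for x by (simp add: p_def)
  have Mp: "w \<bullet> (M *v p x) = 0" for x using M p by (simp add: conformal_def)
  have o: "form u (p x) = 0" "form (p x) u = 0" "form u (M *v p x) = 0" "form (M *v p x) u = 0" for x
    using orthogonal p Mp symmetric by metis+
  have "form (normalized \<mu> r M *v x) (normalized \<mu> r M *v y)
      = (1 / r)\<^sup>2 * form (M *v p x) (M *v p y) + (w \<bullet> x) * (w \<bullet> y) * form u u"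
    unfolding normalized_mult[OF M] p_def[symmetric]
    by (simp add: form_simps o power2_eq_square)
  also have "form (M *v p x) (M *v p y) = r\<^sup>2 * form (p x) (p y)"
    using M p by (simp add: conformal_def)
  also have "(1 / r)\<^sup>2 * (r\<^sup>2 * form (p x) (p y)) = form (p x) (p y)"
    using r by (simp add: power_divide)
  also have "form (p x) (p y) + (w \<bullet> x) * (w \<bullet> y) * form u u
     = form (p x + (w \<bullet> x) *\<^sub>R u) (p y + (w \<bullet> y) *\<^sub>R u)"
    by (simp add: form_simps o)
  finally show ?thesis by (simp only: split[symmetric])
qed

lemma normalized_inverse:
  assumes M: "conformal \<mu> r M" and M': "conformal (1 / \<mu>) (1 / r) M'"
    and "r \<noteq> 0" and inv: "M ** M' = mat 1"
  shows "normalized \<mu> r M ** normalized (1 / \<mu>) (1 / r) M' = mat 1"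
proof -
  have "normalized \<mu> r M *v (normalized (1 / \<mu>) (1 / r) M' *v x) = x" for x
  proof -
    define p where "p = x - (w \<bullet> x) *\<^sub>R u"
    have "w \<bullet> p = 0" using pairing by (simp add: p_def inner_diff_right)
    then have M'p: "w \<bullet> (M' *v p) = 0" using M' by (simp add: conformal_def)
    have "M *v (M' *v p) = p" using inv by (simp add: matrix_vector_mul_assoc)
    then show ?thesis
      unfolding normalized_mult[OF M'] normalized_mult[OF M] p_def[symmetric]
      using M'p pairing \<open>r \<noteq> 0\<close>
      by (simp add: inner_add_right matrix_vector_mult_scaleR) (simp add: p_def)
  qed
  then show ?thesis by (simp add: matrix_eq matrix_vector_mul_assoc[symmetric])
qed

text \<open>
  Here \<open>r\<close> times the normalized matrix is \<open>M\<close> composed with the map that is 1 on the hyperplane and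
  \<open>r / \<mu>\<close> on the line. That map is a rank-one perturbation of the identity.
\<close>

lemma det_normalized:
  assumes M: "conformal \<mu> r M" and "\<mu> \<noteq> 0" "r \<noteq> 0"
  shows "det (normalized \<mu> r M) * (r ^ CARD('n) * \<mu>) = r * det M"
proof -
  let ?S = "mat 1 + (\<chi> i j. ((r / \<mu> - 1) *\<^sub>R u) $ i * w $ j)"
  have "r *\<^sub>R normalized \<mu> r M = M ** ?S"
  proof -
    have S: "?S *v x = x + ((r / \<mu> - 1) * (w \<bullet> x)) *\<^sub>R u" for x
    proof -
      have "(\<chi> i j. ((r / \<mu> - 1) *\<^sub>R u) $ i * w $ j) = (r / \<mu> - 1) *\<^sub>R proj"
        by (simp add: proj_def vec_eq_iff)
      then show ?thesis
        by (simp add: matrix_vector_mult_add_rdistrib proj_mult scaleR_matrix_vector_assoc[symmetric])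
    qed
    have "(r *\<^sub>R normalized \<mu> r M) *v x = (M ** ?S) *v x" for x
      unfolding matrix_vector_mul_assoc[symmetric] S scaleR_matrix_vector_assoc[symmetric]
        normalized_mult[OF M]
      using M assms(2,3)
      by (simp add: conformal_def matrix_vector_mult_diff_distrib matrix_vector_right_distrib
          matrix_vector_mult_scaleR algebra_simps)
    then show ?thesis by (simp add: matrix_eq)
  qed
  then have "det (r *\<^sub>R normalized \<mu> r M) = det M * (1 + (\<Sum>i\<in>UNIV. ((r / \<mu> - 1) *\<^sub>R u) $ i * w $ i))"
    by (simp only: det_mul det_mat_1_plus_rank_one)
  also have "(\<Sum>i\<in>UNIV. ((r / \<mu> - 1) *\<^sub>R u) $ i * w $ i) = (r / \<mu> - 1) * (w \<bullet> u)"
    by (simp add: inner_vec_def sum_distrib_left mult_ac)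
  also have "det (r *\<^sub>R normalized \<mu> r M) = r ^ CARD('n) * det (normalized \<mu> r M)"
    using det_rows_mul[of "\<lambda>_. r" "\<lambda>i. normalized \<mu> r M $ i"]
    by (simp add: scalar_mult_eq_scaleR scaleR_vec_def)
  finally show ?thesis using assms(2) pairing by (simp add: field_simps)
qed

lemma conformal_det:
  assumes "conformal \<mu> r M" "\<bar>det M\<bar> = 1" "r > 0" "\<mu> \<noteq> 0"
  shows "\<bar>\<mu>\<bar> * r ^ (CARD('n) - 1) = 1"
proof -
  have "\<bar>det (normalized \<mu> r M)\<bar> = 1"
    using assms by (intro isometry_det normalized_isometry) auto
  then have "r ^ CARD('n) * \<bar>\<mu>\<bar> = r"
    using arg_cong[OF det_normalized[OF assms(1)], of abs] assms by (simp add: abs_mult)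
  moreover have "r ^ CARD('n) = r * r ^ (CARD('n) - 1)"
    by (simp flip: power_Suc)
  ultimately show ?thesis using assms by (simp add: mult.commute)
qed

text \<open>
  In terms of eigenvalues: those on the hyperplane have modulus \<open>r\<close> and come in conjugate pairs, so the
  sum of their inverses is their sum divided by \<open>r\<^sup>2\<close>.
\<close>

lemma conformal_trace_inverse:
  assumes "conformal \<mu> r M" "conformal (1 / \<mu>) (1 / r) M'" "M ** M' = mat 1" "r \<noteq> 0"
  shows "trace M - \<mu> = r\<^sup>2 * (trace M' - 1 / \<mu>)"
proof -
  have "trace (normalized (1 / \<mu>) (1 / r) M') = trace (normalized \<mu> r M)"
    using assms by (intro isometry_trace_inverse normalized_isometry normalized_inverse) auto
  then show ?thesis using assms(4) by (simp add: trace_normalized field_simps power2_eq_square)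
qed

lemma conformal_trace_bound:
  obtains D where "D \<ge> 0" "\<And>\<mu> r M. conformal \<mu> r M \<Longrightarrow> r > 0 \<Longrightarrow> \<bar>trace M - \<mu>\<bar> \<le> D * r"
proof -
  obtain C where C: "\<And>N. (\<And>x y. form (N *v x) (N *v y) = form x y) \<Longrightarrow> \<bar>trace N\<bar> \<le> C"
    using form_trace_bound by blast
  show thesis
  proof (rule that[of "C + 1"])
    show "C + 1 \<ge> 0" using C[of "mat 1"] by simp
    fix \<mu> r M assume "conformal \<mu> r M" "(r::real) > 0"
    then have "\<bar>1 + (trace M - \<mu>) / r\<bar> \<le> C"
      using C[of "normalized \<mu> r M"] normalized_isometry by (simp add: trace_normalized)
    then have "\<bar>(trace M - \<mu>) / r\<bar> \<le> C + 1" by linarith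
    then show "\<bar>trace M - \<mu>\<bar> \<le> (C + 1) * r"
      using \<open>r > 0\<close> by (simp add: abs_divide field_simps)
  qed
qed

lemma conformal_power:
  assumes "conformal \<mu> r M"
  shows "conformal (\<mu> ^ k) (r ^ k) (matrix_power M k)"
proof (induction k)
  case 0
  then show ?case by (simp add: conformal_def)
next
  case (Suc k)
  then show ?case using assms
    by (simp add: conformal_def matrix_vector_mul_assoc[symmetric] matrix_vector_mult_scaleR
        power_mult_distrib)
qed

lemma conformal_inverse:
  assumes M: "conformal \<mu> r M" and "\<mu> \<noteq> 0" "r \<noteq> 0" and inv: "M ** M' = mat 1"
  shows "conformal (1 / \<mu>) (1 / r) M'"
proof -
  have inv': "M' ** M = mat 1" using inv matrix_left_right_inverse by blast
  have c: "M *v (M' *v x) = x" "M' *v (M *v x) = x" for x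
    using inv inv' by (simp_all add: matrix_vector_mul_assoc)
  have w: "w \<bullet> (M' *v x) = 1 / \<mu> * (w \<bullet> x)" for x
    using M[unfolded conformal_def] c(1)[of x] \<open>\<mu> \<noteq> 0\<close> by (metis mult.commute nonzero_mult_div_cancel_left times_divide_eq_right mult_1_right)
  have "M' *v u = (1 / \<mu>) *\<^sub>R (M' *v (M *v u))"
    using M \<open>\<mu> \<noteq> 0\<close> by (simp add: conformal_def matrix_vector_mult_scaleR)
  then have u: "M' *v u = (1 / \<mu>) *\<^sub>R u" by (simp add: c)
  have "form (M' *v x) (M' *v y) = (1 / r)\<^sup>2 * form x y" if "w \<bullet> x = 0" "w \<bullet> y = 0" for x y
  proof -
    have "form x y = r\<^sup>2 * form (M' *v x) (M' *v y)"
      using M w that c unfolding conformal_def by (metis mult_zero_right)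
    then show ?thesis using \<open>r \<noteq> 0\<close> by (simp add: power_divide)
  qed
  then show ?thesis using w u by (simp add: conformal_def)
qed

end

section \<open>Integral conformal matrices\<close>

context adapted_form
begin

lemma form_nonneg: "form x x \<ge> 0"
  using positive[of x] bilinear_lzero[OF bilinear, of x] by (cases "x = 0") (auto intro: less_imp_le)

lemma matrix_power_form_le:
  assumes "\<And>x. w \<bullet> x = 0 \<Longrightarrow> w \<bullet> (M *v x) = 0"
    and "\<And>x. w \<bullet> x = 0 \<Longrightarrow> form (M *v x) (M *v x) \<le> c * form x x"
    and "c \<ge> 0" and v: "w \<bullet> v = 0"
  shows "form (matrix_power M k *v v) (matrix_power M k *v v) \<le> c ^ k * form v v"
proof -
  have "w \<bullet> (matrix_power M k *v v) = 0 \<and>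
      form (matrix_power M k *v v) (matrix_power M k *v v) \<le> c ^ k * form v v"
  proof (induction k)
    case (Suc k)
    let ?y = "matrix_power M k *v v"
    have "form (M *v ?y) (M *v ?y) \<le> c * form ?y ?y" using Suc assms by blast
    also have "\<dots> \<le> c * (c ^ k * form v v)" using Suc assms by (intro mult_left_mono) auto
    finally show ?case using Suc assms by (simp add: matrix_vector_mul_assoc[symmetric] mult.assoc)
  qed (simp add: v)
  then show ?thesis ..
qed

lemma matrix_power_form_ge:
  assumes "\<And>x. w \<bullet> x = 0 \<Longrightarrow> w \<bullet> (M *v x) = 0"
    and "\<And>x. w \<bullet> x = 0 \<Longrightarrow> c * form x x \<le> form (M *v x) (M *v x)"
    and "c \<ge> 0" and v: "w \<bullet> v = 0"
  shows "w \<bullet> (matrix_power M k *v v) = 0 \<and>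
      c ^ k * form v v \<le> form (matrix_power M k *v v) (matrix_power M k *v v)"
proof (induction k)
  case (Suc k)
  let ?y = "matrix_power M k *v v"
  have "c * (c ^ k * form v v) \<le> c * form ?y ?y" using Suc assms by (intro mult_left_mono) auto
  also have "\<dots> \<le> form (M *v ?y) (M *v ?y)" using Suc assms by blast
  finally show ?case using Suc assms by (simp add: matrix_vector_mul_assoc[symmetric] mult.assoc)
qed (simp add: v)

text \<open>
  The stable component of an integer vector in the kernel of \<open>F\<close> is again in the kernel. It does not
  vanish, since otherwise the integer vector would be a multiple of \<open>u\<close>, which the integer matrix \<open>B'\<close>
  contracts.
\<close>

lemma annihilated_stable_vector:
  fixes B B' F :: "int ^ 'n ^ 'n"
  assumes B: "conformal \<mu> r (real_mat B)" and inv: "B ** B' = mat 1"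
    and "r \<noteq> 0" "\<bar>\<mu>\<bar> > 1" and Fu: "real_mat F *v u = 0"
  obtains v where "v \<noteq> 0" "w \<bullet> v = 0" "real_mat F *v v = 0"
proof -
  have "u \<noteq> 0" using pairing by auto
  then have "\<not> invertible (real_mat F)"
    using Fu matrix_left_invertible_ker[of "real_mat F"] by (auto simp: invertible_left_inverse)
  then have "det (real_mat F) = 0" by (simp add: invertible_det_nz)
  then have "det F = 0" using det_map_matrix_of_int[of F, where 'a=real] by simp
  then obtain y where y: "y \<noteq> 0" "F *v y = 0" using singular_int_matrix_kernel by blast
  define Y where "Y = (\<chi> i. real_of_int (y $ i))"
  have FY: "real_mat F *v Y = 0" by (simp add: Y_def map_matrix_of_int_mult_vec y vec_eq_iff)
  let ?v = "Y - (w \<bullet> Y) *\<^sub>R u"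
  have "?v \<noteq> 0"
  proof
    assume "?v = 0"
    then have Yu: "Y = (w \<bullet> Y) *\<^sub>R u" by simp
    have "real_mat B ** real_mat B' = mat 1"
      using arg_cong[OF inv, of real_mat] by (simp add: map_matrix_of_int_mult map_matrix_of_int_mat)
    then have "conformal (1 / \<mu>) (1 / r) (real_mat B')"
      using assms by (intro conformal_inverse[OF B]) auto
    then have "real_mat B' *v u = (1 / \<mu>) *\<^sub>R u" by (simp add: conformal_def)
    then have "real_mat B' *v ((w \<bullet> Y) *\<^sub>R u) = (1 / \<mu>) *\<^sub>R ((w \<bullet> Y) *\<^sub>R u)"
      by (simp add: matrix_vector_mult_scaleR)
    then have "real_mat B' *v Y = (1 / \<mu>) *\<^sub>R Y" by (simp only: Yu[symmetric])
    then have "y = 0"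
      unfolding Y_def
      by (rule contracted_eigenvector_not_integral) (use assms(4) in auto)
    then show False using y by simp
  qed
  moreover have "w \<bullet> ?v = 0" using pairing by (simp add: inner_diff_right)
  moreover have "real_mat F *v ?v = 0"
    by (simp add: matrix_vector_mult_diff_distrib matrix_vector_mult_scaleR FY Fu)
  ultimately show thesis by (rule that)
qed

text \<open>
  The integer matrix \<open>F\<close> in the proof encodes the integral polynomial relation that \<open>\<mu>\<close> satisfies by
  \<open>conformal_trace_inverse\<close>. The inequality compares the lengths of its two terms on a stable vector that
  \<open>F\<close> kills. The factors 2 and 1/2 belong to the estimates \<open>Pf\<close> and \<open>Rf\<close>, which come from
  expanding the form of a sum that is at least 0, without a triangle inequality; they do no harm
  because only the growth rate in \<open>r\<close> counts later.
\<close>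

lemma conformal_integral_bound:
  fixes B B' :: "int ^ 'n ^ 'n"
  assumes B: "conformal \<mu> r (real_mat B)" and inv: "B ** B' = mat 1"
    and r: "0 < r" and mu: "\<bar>\<mu>\<bar> > 1" and mur: "\<bar>\<mu>\<bar> * r ^ q = 1"
    and t: "t = real_of_int (trace B)" and s: "s = real_of_int (trace B')"
    and tr: "r\<^sup>2 \<le> t\<^sup>2 / 2"
  shows "(r\<^sup>2) ^ (q + 2) * (t\<^sup>2 / 2 - r\<^sup>2) ^ q \<le> (2 * (s\<^sup>2 * r\<^sup>2 + 1)) ^ q"
proof -
  let ?M = "real_mat B"
  have Minv: "?M ** real_mat B' = mat 1"
    using arg_cong[OF inv, of real_mat] by (simp add: map_matrix_of_int_mult map_matrix_of_int_mat)
  have M': "conformal (1 / \<mu>) (1 / r) (real_mat B')"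
    using Minv r mu by (intro conformal_inverse[OF B]) auto
  have Mu: "?M *v u = \<mu> *\<^sub>R u" and Mw: "\<And>x. w \<bullet> (?M *v x) = \<mu> * (w \<bullet> x)"
    and Mf: "\<And>x. w \<bullet> x = 0 \<Longrightarrow> form (?M *v x) (?M *v x) = r\<^sup>2 * form x x"
    using B by (auto simp: conformal_def)
  define P where "P = mat s ** ?M - mat 1"
  define R where "R = mat t - ?M"
  have P: "P *v x = s *\<^sub>R (?M *v x) - x" for x
    by (simp add: P_def matrix_vector_mult_diff_rdistrib mat_mult_vec matrix_vector_mul_assoc[symmetric])
  have R: "R *v x = t *\<^sub>R x - ?M *v x" for x
    by (simp add: R_def matrix_vector_mult_diff_rdistrib mat_mult_vec)
  define F where "F = matrix_power (mat (trace B') ** B - mat 1) q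
      - matrix_power B (q + 2) ** matrix_power (mat (trace B) - B) q"
  have F: "real_mat F = matrix_power P q - matrix_power ?M (q + 2) ** matrix_power R q"
    by (simp only: F_def P_def R_def s t map_matrix_of_int_power map_matrix_of_int_mult
        map_matrix_of_int_diff map_matrix_of_int_mat of_int_1)
  have "real_mat F *v u = 0"
  proof -
    have "P *v u = (s * \<mu> - 1) *\<^sub>R u" "R *v u = (t - \<mu>) *\<^sub>R u"
      by (simp_all add: P R Mu algebra_simps)
    note eigen = this[THEN matrix_power_eigenvector] Mu[THEN matrix_power_eigenvector]
    have "real_mat F *v u = ((s * \<mu> - 1) ^ q - (t - \<mu>) ^ q * \<mu> ^ (q + 2)) *\<^sub>R u"
      unfolding F matrix_vector_mult_diff_rdistrib matrix_vector_mul_assoc[symmetric]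
      by (simp only: eigen matrix_vector_mult_scaleR scaleR_scaleR scaleR_diff_left)
    moreover have "(t - \<mu>) ^ q * \<mu> ^ (q + 2) = (s * \<mu> - 1) ^ q"
    proof -
      have "t - \<mu> = r\<^sup>2 * (s - 1 / \<mu>)"
        using conformal_trace_inverse[OF B M' Minv] r by (simp add: s t trace_map_matrix_of_int)
      then have "(t - \<mu>) ^ q * \<mu> ^ (q + 2) = (r\<^sup>2 * (s - 1 / \<mu>)) ^ q * \<mu> ^ (q + 2)" by simp
      \<comment> \<open>Two of the factors \<open>\<mu>\<close> absorb \<open>(r\<^sup>2) ^ q\<close>, the others clear the denominators.\<close>
      also have "\<dots> = (\<bar>\<mu>\<bar> * r ^ q)\<^sup>2 * ((s - 1 / \<mu>) * \<mu>) ^ q"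
        by (simp add: power_mult_distrib power_add power_mult[symmetric] power2_eq_square[of \<mu>] mult_ac)
      also have "(s - 1 / \<mu>) * \<mu> = s * \<mu> - 1" using mu by (simp add: field_simps)
      finally show ?thesis by (simp add: mur)
    qed
    ultimately show ?thesis by simp
  qed
  then obtain v where v: "v \<noteq> 0" "w \<bullet> v = 0" and Fv: "real_mat F *v v = 0"
    using annihilated_stable_vector[OF B inv _ mu] r by blast
  define y where "y = matrix_power R q *v v"
  have PwR: "w \<bullet> (P *v x) = 0" "w \<bullet> (R *v x) = 0" if "w \<bullet> x = 0" for x
    using that by (simp_all add: P R inner_diff_right Mw)
  have Pf: "form (P *v x) (P *v x) \<le> 2 * (s\<^sup>2 * r\<^sup>2 + 1) * form x x" if "w \<bullet> x = 0" for x
    using form_nonneg[of "s *\<^sub>R (?M *v x) + x"] Mf[OF that] symmetric[of x "?M *v x"]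
    by (simp add: P form_simps power2_eq_square algebra_simps)
  have Rf: "(t\<^sup>2 / 2 - r\<^sup>2) * form x x \<le> form (R *v x) (R *v x)" if "w \<bullet> x = 0" for x
    using form_nonneg[of "t *\<^sub>R x - 2 *\<^sub>R (?M *v x)"] Mf[OF that] symmetric[of x "?M *v x"]
    by (simp add: R form_simps power2_eq_square algebra_simps)
  have y: "w \<bullet> y = 0 \<and> (t\<^sup>2 / 2 - r\<^sup>2) ^ q * form v v \<le> form y y"
    unfolding y_def by (rule matrix_power_form_ge) (use PwR Rf tr v in auto)
  have "(r\<^sup>2) ^ (q + 2) * form y y \<le> form (matrix_power ?M (q + 2) *v y) (matrix_power ?M (q + 2) *v y)"
    by (rule matrix_power_form_ge[THEN conjunct2]) (use Mw Mf y in auto)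
  also have "matrix_power ?M (q + 2) *v y = matrix_power P q *v v"
    using Fv unfolding F matrix_vector_mult_diff_rdistrib y_def by (simp add: matrix_vector_mul_assoc)
  also have "form (matrix_power P q *v v) (matrix_power P q *v v) \<le> (2 * (s\<^sup>2 * r\<^sup>2 + 1)) ^ q * form v v"
    by (rule matrix_power_form_le) (use PwR Pf v in auto)
  finally have "(r\<^sup>2) ^ (q + 2) * form y y \<le> (2 * (s\<^sup>2 * r\<^sup>2 + 1)) ^ q * form v v" .
  moreover have "(r\<^sup>2) ^ (q + 2) * ((t\<^sup>2 / 2 - r\<^sup>2) ^ q * form v v) \<le> (r\<^sup>2) ^ (q + 2) * form y y"
    using y by (intro mult_left_mono) auto
  ultimately have "((r\<^sup>2) ^ (q + 2) * (t\<^sup>2 / 2 - r\<^sup>2) ^ q) * form v v \<le> (2 * (s\<^sup>2 * r\<^sup>2 + 1)) ^ q * form v v"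
    by (simp add: mult.assoc)
  then show ?thesis using positive[OF v(1)] by (simp only: mult_le_cancel_right_pos)
qed

end

text \<open>
  The hypothesis \<open>bound\<close> has a left-hand side of order \<open>r powr (2 * q + 4 - 2 * q * q)\<close>, because \<open>t\<close> has the size
  of \<open>\<mu>\<close>, and a bounded right-hand side, because \<open>s\<close> has at most the size of \<open>1 / r\<close>. For \<open>q \<ge> 3\<close> the
  exponent is negative, which keeps \<open>r\<close> away from 0; the upper bounds on \<open>r\<close> make the comparison of sizes
  precise.
\<close>

lemma contraction_ratio_not_small:
  fixes r \<mu> t s D :: real
  assumes q: "q \<ge> 3" and D: "D \<ge> 0" and r: "0 < r" "r \<le> 1 / 16" "2 * D * r \<le> 1"
    and mu: "\<bar>\<mu>\<bar> * r ^ q = 1"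
    and t: "\<bar>t - \<mu>\<bar> \<le> D * r" and s: "\<bar>s - 1 / \<mu>\<bar> \<le> D * (1 / r)"
    and bound: "r\<^sup>2 \<le> t\<^sup>2 / 2 \<Longrightarrow>
      (r\<^sup>2) ^ (q + 2) * (t\<^sup>2 / 2 - r\<^sup>2) ^ q \<le> (2 * (s\<^sup>2 * r\<^sup>2 + 1)) ^ q"
  shows "1 \<le> (32 * ((1 + D)\<^sup>2 + 1)) ^ q * r"
proof -
  define a where "a = r ^ q"
  have a: "0 < a" "a \<le> 1" using r by (auto simp: a_def power_le_one)
  have mua: "\<bar>\<mu>\<bar> = 1 / a" using mu a unfolding a_def[symmetric] by (simp add: field_simps)
  have "1 \<le> 1 / a" using a by simp
  moreover have "1 / (2 * a) = (1 / a) / 2" by simp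
  ultimately have "1 / (2 * a) \<le> 1 / a - D * r" using r by linarith
  then have "1 / (2 * a) \<le> \<bar>t\<bar>" using t mua by linarith
  then have "(1 / (2 * a))\<^sup>2 \<le> \<bar>t\<bar>\<^sup>2" using a by (intro power_mono) auto
  then have t2: "1 / (4 * a\<^sup>2) \<le> t\<^sup>2" by (simp add: power_divide power_mult_distrib)
  have "a\<^sup>2 * r\<^sup>2 \<le> 1 * (1 / 16)\<^sup>2"
    using a r by (intro mult_mono power_mono power_le_one) auto
  then have "r\<^sup>2 \<le> 1 / (16 * a\<^sup>2)" using a by (simp add: field_simps)
  then have t3: "1 / (16 * a\<^sup>2) \<le> t\<^sup>2 / 2 - r\<^sup>2" using t2 a by (simp add: field_simps)
  have "\<bar>s\<bar> \<le> \<bar>1 / \<mu>\<bar> + D * (1 / r)" using s by linarith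
  also have "\<bar>1 / \<mu>\<bar> = a" using mua a by (simp add: abs_divide)
  finally have "\<bar>s\<bar> * r \<le> a * r + D" using r by (simp add: field_simps)
  also have "a * r \<le> 1" using a r by (intro mult_le_one) auto
  finally have "(\<bar>s\<bar> * r)\<^sup>2 \<le> (1 + D)\<^sup>2" using r by (intro power_mono) auto
  then have s2: "s\<^sup>2 * r\<^sup>2 \<le> (1 + D)\<^sup>2" by (simp add: power_mult_distrib)
  have "(r\<^sup>2) ^ (q + 2) * (1 / (16 * a\<^sup>2)) ^ q \<le> (r\<^sup>2) ^ (q + 2) * (t\<^sup>2 / 2 - r\<^sup>2) ^ q"
    using t3 a by (intro mult_left_mono power_mono) auto
  also have "\<dots> \<le> (2 * (s\<^sup>2 * r\<^sup>2 + 1)) ^ q"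
  proof (rule bound)
    have "0 \<le> 1 / (16 * a\<^sup>2)" by simp
    then show "r\<^sup>2 \<le> t\<^sup>2 / 2" using t3 by linarith
  qed
  also have "\<dots> \<le> (2 * ((1 + D)\<^sup>2 + 1)) ^ q"
    using s2 by (intro power_mono) auto
  finally have "(r\<^sup>2) ^ (q + 2) \<le> (2 * ((1 + D)\<^sup>2 + 1)) ^ q * (16 * a\<^sup>2) ^ q"
    using a by (simp add: power_divide field_simps)
  also have "\<dots> = (32 * ((1 + D)\<^sup>2 + 1)) ^ q * (a\<^sup>2) ^ q"
    by (simp only: power_mult_distrib[symmetric]) (simp add: mult_ac)
  finally have le: "(r\<^sup>2) ^ (q + 2) \<le> (32 * ((1 + D)\<^sup>2 + 1)) ^ q * (a\<^sup>2) ^ q" .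
  have "(a\<^sup>2) ^ q \<le> (r\<^sup>2) ^ (q + 2) * r"
  proof -
    have "2 * (q + 2) + 1 \<le> 2 * (3 * q)" using q by simp
    also have "\<dots> \<le> 2 * (q * q)" using q by (intro mult_left_mono mult_right_mono) auto
    also have "\<dots> = q * 2 * q" by simp
    finally have le: "2 * (q + 2) + 1 \<le> q * 2 * q" .
    have "(a\<^sup>2) ^ q = r ^ (q * 2 * q)" by (simp add: a_def power_mult[symmetric] mult_ac)
    also have "\<dots> \<le> r ^ (2 * (q + 2) + 1)" using le r by (intro power_decreasing) auto
    also have "\<dots> = (r\<^sup>2) ^ (q + 2) * r"
      by (simp only: power_add[of r _ 1] power_mult[of r 2] power_one_right)
    finally show ?thesis .
  qed
  then have "(32 * ((1 + D)\<^sup>2 + 1)) ^ q * (a\<^sup>2) ^ q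
      \<le> (32 * ((1 + D)\<^sup>2 + 1)) ^ q * ((r\<^sup>2) ^ (q + 2) * r)"
    by (intro mult_left_mono) auto
  with le have "(r\<^sup>2) ^ (q + 2) \<le> (32 * ((1 + D)\<^sup>2 + 1)) ^ q * ((r\<^sup>2) ^ (q + 2) * r)"
    by (rule order_trans)
  then have "(r\<^sup>2) ^ (q + 2) * 1 \<le> (r\<^sup>2) ^ (q + 2) * ((32 * ((1 + D)\<^sup>2 + 1)) ^ q * r)"
    by (simp only: mult_1_right mult.left_commute)
  then show ?thesis using r by (simp only: mult_le_cancel_left_pos zero_less_power)
qed

text \<open>
  A high power of \<open>A\<close> has a ratio that violates \<open>contraction_ratio_not_small\<close>, while the constant \<open>D\<close> there
  is the same for all powers.
\<close>

lemma (in adapted_form) integral_conformal_dimension: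
  fixes A :: "int ^ 'n ^ 'n"
  assumes card: "CARD('n) = q + 1" and q: "q \<ge> 1" and det: "det A = 1"
    and A: "conformal \<mu> r (real_mat A)" and r: "0 < r" "r < 1" and "\<mu> \<noteq> 0"
  shows "q \<le> 2"
proof (rule ccontr)
  assume "\<not> q \<le> 2"
  then have q3: "q \<ge> 3" by simp
  obtain A' where A': "A ** A' = mat 1" using unimodular_int_matrix_inverse[OF det] .
  obtain D where D: "D \<ge> 0" "\<And>\<mu> r M. conformal \<mu> r M \<Longrightarrow> r > 0 \<Longrightarrow> \<bar>trace M - \<mu>\<bar> \<le> D * r"
    using conformal_trace_bound by blast
  define K where "K = (32 * ((1 + D)\<^sup>2 + 1)) ^ q"
  have K: "K > 0" unfolding K_def by (intro zero_less_power) (simp add: add_nonneg_pos)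
  \<comment> \<open>The first two bounds are needed to apply \<open>contraction_ratio_not_small\<close>, the third one contradicts it.\<close>
  define e where "e = min (1 / 16) (min (1 / (2 * D + 1)) (1 / K))"
  have e: "e > 0" using K D by (simp add: e_def)
  obtain k where k: "r ^ k < e" using real_arch_pow_inv[OF e r(2)] by blast
  define R where "R = r ^ k"
  define m where "m = \<mu> ^ k"
  have R: "0 < R" "R < 1 / 16" "R < 1 / (2 * D + 1)" "R < 1 / K"
    using k r by (auto simp: R_def e_def)
  let ?B = "matrix_power A k" and ?B' = "matrix_power A' k"
  have B: "conformal m R (real_mat ?B)"
    unfolding m_def R_def map_matrix_of_int_power by (rule conformal_power[OF A])
  have inv: "?B ** ?B' = mat 1" by (rule matrix_power_inverse[OF A'])
  have rinv: "real_mat ?B ** real_mat ?B' = mat 1"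
    using arg_cong[OF inv, of real_mat] by (simp add: map_matrix_of_int_mult map_matrix_of_int_mat)
  have m0: "m \<noteq> 0" using \<open>\<mu> \<noteq> 0\<close> by (simp add: m_def)
  have B': "conformal (1 / m) (1 / R) (real_mat ?B')"
    using conformal_inverse[OF B m0 _ rinv] R by simp
  have "det ?B * det ?B' = 1" using arg_cong[OF inv, of det] by (simp add: det_mul)
  then have "\<bar>det ?B\<bar> = 1" using zmult_eq_1_iff by fastforce
  then have "\<bar>det (real_mat ?B)\<bar> = 1"
    unfolding det_map_matrix_of_int by (simp flip: of_int_abs)
  then have mR: "\<bar>m\<bar> * R ^ q = 1" using conformal_det[OF B _ R(1) m0] card by simp
  moreover have "R ^ q < 1" using R q by (simp add: power_less_one_iff)
  moreover have "R ^ q > 0" using R by simp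
  ultimately have m: "\<bar>m\<bar> > 1"
    using mult_right_mono[of "\<bar>m\<bar>" 1 "R ^ q"] by linarith
  have "2 * D * R \<le> 1"
    using R D by (simp add: field_simps)
  have "1 \<le> K * R"
    unfolding K_def
  proof (rule contraction_ratio_not_small[OF q3 D(1) R(1) _ \<open>2 * D * R \<le> 1\<close> mR])
    show "R \<le> 1 / 16" using R by simp
    show "\<bar>real_of_int (trace ?B) - m\<bar> \<le> D * R"
      using D(2)[OF B R(1)] by (simp add: trace_map_matrix_of_int)
    show "\<bar>real_of_int (trace ?B') - 1 / m\<bar> \<le> D * (1 / R)"
      using D(2)[OF B'] R by (simp add: trace_map_matrix_of_int)
  qed (rule conformal_integral_bound[OF B inv R(1) m mR refl refl])
  then show False using R K by (simp add: field_simps)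
qed

section \<open>Reduction to an adapted form\<close>

lemma line_spanned:
  assumes "subspace E" "dim E = 1"
  obtains u where "u \<noteq> 0" "E = span {u}"
proof -
  obtain B where B: "B \<subseteq> E" "independent B" "E \<subseteq> span B" "card B = dim E"
    using basis_exists[of E] by blast
  then obtain u where "B = {u}" using assms(2) card_1_singletonE by metis
  moreover from this have "u \<noteq> 0" using B dependent_zero by blast
  moreover have "E = span B" using B assms(1) by (simp add: span_minimal subset_antisym)
  ultimately show thesis using that by blast
qed

lemma complementary_line_hyperplane:
  fixes S T :: "'a::euclidean_space set"
  assumes "direct_sum_decomp S T" "dim T = 1"
  obtains u w where "T = span {u}" "S = {x. w \<bullet> x = 0}" "w \<bullet> u = 1"
proof -
  have S: "subspace S" and T: "subspace T" and int: "S \<inter> T = {0}"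
    and sum: "{x + y |x y. x \<in> S \<and> y \<in> T} = UNIV"
    using assms by (auto simp: direct_sum_decomp_def)
  obtain u where u: "u \<noteq> 0" "T = span {u}" using line_spanned[OF T assms(2)] by blast
  have "dim S = DIM('a) - 1"
    using dim_sums_Int[OF S T] assms(2) by (simp add: sum int)
  then obtain a where a: "span S = {x. a \<bullet> x = 0}" using lowdim_eq_hyperplane by blast
  then have Sa: "S = {x. a \<bullet> x = 0}" using S by (metis span_eq_iff)
  have "u \<in> T" using u by (simp add: span_base)
  then have au: "a \<bullet> u \<noteq> 0" using u int Sa by blast
  show thesis
    by (rule that[of u "(1 / (a \<bullet> u)) *\<^sub>R a"]) (use u au Sa in auto)
qed

lemma adapted_form_extension:
  fixes u w :: "real ^ 'n"
  assumes b: "pos_def_symmetric_form_on {x. w \<bullet> x = 0} b" and wu: "w \<bullet> u = 1"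
  shows "adapted_form (\<lambda>x y. b (x - (w \<bullet> x) *\<^sub>R u) (y - (w \<bullet> y) *\<^sub>R u) + (w \<bullet> x) * (w \<bullet> y)) u w"
proof -
  define p where "p x = x - (w \<bullet> x) *\<^sub>R u" for x
  have p: "w \<bullet> p x = 0" for x using wu by (simp add: p_def inner_diff_right)
  have padd: "p (x + y) = p x + p y" and psc: "p (c *\<^sub>R x) = c *\<^sub>R p x" for x y c
    by (simp_all add: p_def inner_add_right algebra_simps)
  have badd: "b (x + y) z = b x z + b y z" and bsc: "b (c *\<^sub>R x) y = c * b x y"
    and bsym: "b x y = b y x" and bpos: "x \<noteq> 0 \<Longrightarrow> b x x > 0"
    if "w \<bullet> x = 0" "w \<bullet> y = 0" "w \<bullet> z = 0" for x y z c
    using b that by (auto simp: pos_def_symmetric_form_on_def)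
  have badd': "b z (x + y) = b z x + b z y" and bsc': "b y (c *\<^sub>R x) = c * b y x"
    if "w \<bullet> x = 0" "w \<bullet> y = 0" "w \<bullet> z = 0" for x y z c
    using that badd[of x y z] bsym[of z "x + y" 0] bsym[of z x 0] bsym[of z y 0]
      bsc[of x y 0 c] bsym[of y "c *\<^sub>R x" 0] bsym[of y x 0]
    by (simp_all add: inner_add_right)
  show ?thesis
    unfolding p_def[symmetric]
  proof unfold_locales
    show "bilinear (\<lambda>x y. b (p x) (p y) + (w \<bullet> x) * (w \<bullet> y))"
      unfolding bilinear_def linear_iff
      by (auto simp: padd psc badd badd' bsc[where z=0] bsc'[where z=0] p inner_add_right algebra_simps)
    show "b (p x) (p y) + (w \<bullet> x) * (w \<bullet> y) = b (p y) (p x) + (w \<bullet> y) * (w \<bullet> x)" for x y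
      using bsym[of "p x" "p y" 0] p by simp
    show "b (p x) (p x) + (w \<bullet> x) * (w \<bullet> x) > 0" if "x \<noteq> 0" for x
    proof (cases "p x = 0")
      case True
      then have "x = (w \<bullet> x) *\<^sub>R u" by (simp add: p_def)
      then have "w \<bullet> x \<noteq> 0" using that by auto
      moreover have "b (p x) (p x) = 0" using True bsc[of 0 0 0 0] by simp
      ultimately show ?thesis by (auto simp: zero_less_mult_iff linorder_neq_iff)
    next
      case False
      then show ?thesis using bpos[of "p x" 0 0] p by (simp add: add_pos_nonneg)
    qed
    show "w \<bullet> u = 1" by (rule wu)
    show "b (p u) (p x) + (w \<bullet> u) * (w \<bullet> x) = 0" if "w \<bullet> x = 0" for x
    proof -
      have "p u = 0" by (simp add: p_def wu)
      then show ?thesis using that bsc[of 0 "p x" 0 0] p by simp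
    qed
  qed
qed

theorem proposition3:
  fixes q :: nat
    and A :: "int ^ 'n ^ 'n"
    and Es Eu :: "(real ^ 'n) set"
  assumes "q \<ge> 1"
    and "CARD('n) = q + 1"
    and "A \<in> SL_int"
    and "direct_sum_decomp Es Eu"
    and "invariant_under (real_mat A) Es"
    and "invariant_under (real_mat A) Eu"
    and "dim Eu = 1"
    and "\<exists>b lam. pos_def_symmetric_form_on Es b \<and> lam > 1 \<and> orthogonal_on Es b (lam *\<^sub>R real_mat A)"
  shows "q \<in> {1, 2}"
proof -
  obtain b lam where b: "pos_def_symmetric_form_on Es b" and lam: "lam > 1"
    and orth: "orthogonal_on Es b (lam *\<^sub>R real_mat A)"
    using assms(8) by blast
  obtain u w where Eu: "Eu = span {u}" and Es: "Es = {x. w \<bullet> x = 0}" and wu: "w \<bullet> u = 1"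
    using complementary_line_hyperplane[OF assms(4,7)] by blast
  have det: "det A = 1" using assms(3) by (simp add: SL_int_def)
  let ?M = "real_mat A"
  have "?M *v u \<in> Eu" using assms(6) Eu by (simp add: invariant_under_def span_base)
  then obtain \<mu> where Mu: "?M *v u = \<mu> *\<^sub>R u" unfolding Eu by (auto simp: span_singleton)
  have Mw: "w \<bullet> (?M *v x) = \<mu> * (w \<bullet> x)" for x
  proof -
    let ?p = "x - (w \<bullet> x) *\<^sub>R u"
    have "?p \<in> Es" using wu by (simp add: Es inner_diff_right)
    then have "?M *v ?p \<in> Es" using assms(5) by (simp add: invariant_under_def)
    then show ?thesis
      using wu by (simp add: Es matrix_vector_mult_diff_distrib matrix_vector_mult_scaleR Mu
          inner_diff_right)
  qed
  interpret adapted_form "\<lambda>x y. b (x - (w \<bullet> x) *\<^sub>R u) (y - (w \<bullet> y) *\<^sub>R u) + (w \<bullet> x) * (w \<bullet> y)" u w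
    using adapted_form_extension b wu unfolding Es by blast
  have form: "b (?M *v x) (?M *v y) = (1 / lam)\<^sup>2 * b x y" if "x \<in> Es" "y \<in> Es" for x y
  proof -
    have M: "?M *v x \<in> Es" "?M *v y \<in> Es"
      using that assms(5) by (auto simp: invariant_under_def)
    then have lM: "lam *\<^sub>R (?M *v y) \<in> Es" by (simp add: Es)
    have "b x y = b (lam *\<^sub>R (?M *v x)) (lam *\<^sub>R (?M *v y))"
      using orth that by (simp add: orthogonal_on_def scaleR_matrix_vector_assoc)
    also have "\<dots> = lam * (lam * b (?M *v x) (?M *v y))"
      using b M lM unfolding pos_def_symmetric_form_on_def by metis
    finally show ?thesis using lam by (simp add: power2_eq_square)
  qed
  have "conformal \<mu> (1 / lam) ?M"
    unfolding conformal_def using Mu Mw form by (auto simp: Es)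
  moreover have "\<mu> \<noteq> 0"
  proof
    assume "\<mu> = 0"
    then have "?M *v u = 0" "u \<noteq> 0" using Mu wu by auto
    then have "\<not> invertible ?M"
      using matrix_left_invertible_ker[of ?M] by (auto simp: invertible_left_inverse)
    then show False using det det_map_matrix_of_int[of A, where 'a=real] by (simp add: invertible_det_nz)
  qed
  ultimately have "q \<le> 2"
    using integral_conformal_dimension[OF assms(2,1) det] lam by simp
  then show ?thesis using assms(1) by auto
qed

end
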